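(* Let $\mathcal{A}=\langle S,s^0,L,\Delta\rangle$ be a probabilistic automaton, let $s,s'\in S$, and let $c\subseteq\{(s,a,\mu)\in\Delta\mid a=\tau,\ \mu\text{ is deterministic}\}$ be a weakly probabilistically confluent set of its $\tau$-transitions. If $s\leftrightarrow_c^* s'$, then $s$ and $s'$ are branching probabilistically bisimilar.
   Context: Distributions. $\mathrm{Distr}(S)$ is the set of probability distributions $\mu:S\to[0,1]$, $\sum_{s\in S}\mu(s)=1$, on a countable set $S$. $\mathbb{1}_t$ is the deterministic distribution with $\mathbb{1}_t(t)=1$. For an equivalence relation $R$ on $S$, $\mu\equiv_R\mu'$ means $\mu(C)=\mu'(C)$ for all $C\in S/R$, where $\mu(C)=\sum_{s\in C}\mu(s)$. Probabilistic automata. A probabilistic automaton (PA) is a tuple $\langle S,s^0,L,\Delta\rangle$ with $S$ a countable set of states, $s^0\in S$ initial, $L$ a countable set of actions containing the unobservable action $\tau$, and $\Delta\subseteq S\times L\times\mathrm{Distr}(S)$ a countable transition relation. Write $s\xrightarrow{a}\mu$ for $(s,a,\mu)\in\Delta$, and $s\xrightarrow{a}t$ for $s\xrightarrow{a}\mathbb{1}_t$. Paths and schedulers. A finite path is a sequence $\pi=s_0\,(a_1,\mu_1)\,s_1\,(a_2,\mu_2)\cdots(a_n,\mu_n)\,s_n$ ($n\ge 0$) with $s_{i}\xrightarrow{a_{i+1}}\mu_{i+1}$ and $\mu_{i+1}(s_{i+1})>0$; $\mathrm{last}(\pi)=s_n$. A scheduler $\mathcal{S}$ assigns to every finite path $\pi$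 a probability distribution over $\{\bot\}\cup\Delta$, giving positive probability only to $\bot$ and to transitions $(s,a,\mu)$ with $s=\mathrm{last}(\pi)$ ($\bot$ means stopping). The probability of $\pi$ from $s$ is defined by $P_s^{\mathcal{S}}(s)=1$, $P_s^{\mathcal{S}}(\pi\,(a,\mu)\,t)=P_s^{\mathcal{S}}(\pi)\cdot\mathcal{S}(\pi)(\mathrm{last}(\pi),a,\mu)\cdot\mu(t)$. A maximal path of $\mathcal{S}$ from $s$ is a finite path from $s$ all of whose transitions are scheduled with positive probability after the corresponding prefix and with $\mathcal{S}(\pi)(\bot)>0$. The final state (sub)distribution is $F^{\mathcal{S}}(s)(s')=\sum_{\pi}P_s^{\mathcal{S}}(\pi)\cdot\mathcal{S}(\pi)(\bot)$, over maximal paths $\pi$ of $\mathcal{S}$ from $s$ with $\mathrm{last}(\pi)=s'$. Branching steps. For an equivalence relation $R$ on $S$, $s\Rightarrow^a_R\mu$ if either (1) $a=\tau$ and $\mu=\mathbb{1}_s$, or (2) there is a scheduler $\mathcal{S}$ with $F^{\mathcal{S}}(s)=\mu$ such that every maximal path $s\,(a_1,\mu_1)\,s_1\cdots(a_n,\mu_n)\,s_n$ of $\mathcal{S}$ from $s$ satisfies $a_n=a$ (in particular $n\ge1$) and $a_i=\tau$, $(s,s_i)\in R$ for all $1\le i<n$. Bisimulation. An equivalence relation $R\subseteq S\times S$ is a branching probabilistic bisimulation if for all $(s,t)\in R$: $s\xrightarrow{a}\mu$ implies $\exists\mu'\in\mathrm{Distr}(S)$ with $t\Rightarrow^a_R\mu'$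 and $\mu\equiv_R\mu'$. States $p,q$ are branching probabilistically bisimilar if $(p,q)\in R$ for some branching probabilistic bisimulation $R$. Confluence. Let $c$ be a set of $\tau$-transitions with deterministic distributions. Write $s\to_c t$ if $(s,\tau,\mathbb{1}_t)\in c$; $s\twoheadrightarrow_c t$ if there is a finite (possibly empty) path of $\to_c$-steps from $s$ to $t$; $s\leftrightarrow_c^* t$ if $s$ and $t$ are connected by finitely many (possibly zero) $\to_c$-steps, each of which may be traversed in either direction. Let $R_c=\{(s,s')\mid\exists u:\ s\twoheadrightarrow_c u\text{ and }s'\twoheadrightarrow_c u\}$. The set $c$ is weakly probabilistically confluent if $R_c$ is an equivalence relation and, for every path $s\twoheadrightarrow_c t$ and all $a\in L$, $\mu\in\mathrm{Distr}(S)$: $s\xrightarrow{a}\mu$ implies that there is $t'\in S$ with $t\twoheadrightarrow_c t'$ and [($\exists\nu\in\mathrm{Distr}(S)$: $t'\xrightarrow{a}\nu$ and $\mu\equiv_{R_c}\nu$) or ($a=\tau$ and $\mu\equiv_{R_c}\mathbb{1}_{t'}$)]. *)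

theory Defs
  imports
    "HOL-Probability.Probability_Mass_Function"
    "HOL-Analysis.Infinite_Sum"
begin

text \<open>
  A distribution on a countable set \<open>S\<close> is a probability mass function whose
  support lies in \<open>S\<close>; the deterministic distribution on \<open>t\<close> is \<open>return_pmf t\<close>.
\<close>

definition Distr :: "'s set \<Rightarrow> 's pmf set" where
  "Distr S = {\<mu>. set_pmf \<mu> \<subseteq> S}"

definition dist_equiv :: "'s set \<Rightarrow> ('s \<times> 's) set \<Rightarrow> 's pmf \<Rightarrow> 's pmf \<Rightarrow> bool" where
  "dist_equiv S R \<mu> \<mu>' \<longleftrightarrow>
     (\<forall>C \<in> S // R. measure_pmf.prob \<mu> C = measure_pmf.prob \<mu>' C)"

type_synonym ('s, 'l) transition = "'s \<times> 'l \<times> 's pmf"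

record ('s, 'l) pa =
  states :: "'s set"
  init :: 's
  actions :: "'l set"
  tau :: 'l
  transitions :: "('s, 'l) transition set"

definition prob_automaton :: "('s, 'l) pa \<Rightarrow> bool" where
  "prob_automaton A \<longleftrightarrow>
     countable (states A) \<and> init A \<in> states A \<and>
     countable (actions A) \<and> tau A \<in> actions A \<and>
     transitions A \<subseteq> states A \<times> actions A \<times> Distr (states A) \<and>
     countable (transitions A)"

text \<open>
  Path expressions grow at the end: \<open>Step \<pi> a \<mu> t\<close> is \<open>\<pi>\<close> followed by \<open>(a, \<mu>) t\<close>.
  The predicate \<open>finite_path\<close> singles out those that are paths of a given automaton.
\<close>

datatype ('s, 'l) pa_path =
    Start 's
  | Step "('s, 'l) pa_path" 'l "'s pmf" 's

fun first_state :: "('s, 'l) pa_path \<Rightarrow> 's" where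
  "first_state (Start s) = s"
| "first_state (Step \<pi> a \<mu> t) = first_state \<pi>"

fun last_state :: "('s, 'l) pa_path \<Rightarrow> 's" where
  "last_state (Start s) = s"
| "last_state (Step \<pi> a \<mu> t) = t"

fun finite_path :: "('s, 'l) pa \<Rightarrow> ('s, 'l) pa_path \<Rightarrow> bool" where
  "finite_path A (Start s) \<longleftrightarrow> s \<in> states A"
| "finite_path A (Step \<pi> a \<mu> t) \<longleftrightarrow>
     finite_path A \<pi> \<and> (last_state \<pi>, a, \<mu>) \<in> transitions A \<and> pmf \<mu> t > 0"

text \<open>
  Schedulers are total functions on path expressions, constrained only on the finite paths of
  the automaton; \<open>None\<close> means stopping.
\<close>

type_synonym ('s, 'l) scheduler = "('s, 'l) pa_path \<Rightarrow> ('s, 'l) transition option pmf"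

definition is_scheduler :: "('s, 'l) pa \<Rightarrow> ('s, 'l) scheduler \<Rightarrow> bool" where
  "is_scheduler A \<sigma> \<longleftrightarrow>
     (\<forall>\<pi>. finite_path A \<pi> \<longrightarrow>
        set_pmf (\<sigma> \<pi>) \<subseteq> insert None (Some ` {tr \<in> transitions A. fst tr = last_state \<pi>}))"

fun path_prob :: "('s, 'l) scheduler \<Rightarrow> ('s, 'l) pa_path \<Rightarrow> real" where
  "path_prob \<sigma> (Start s) = 1"
| "path_prob \<sigma> (Step \<pi> a \<mu> t) =
     path_prob \<sigma> \<pi> * pmf (\<sigma> \<pi>) (Some (last_state \<pi>, a, \<mu>)) * pmf \<mu> t"

fun scheduled :: "('s, 'l) scheduler \<Rightarrow> ('s, 'l) pa_path \<Rightarrow> bool" where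
  "scheduled \<sigma> (Start s) \<longleftrightarrow> True"
| "scheduled \<sigma> (Step \<pi> a \<mu> t) \<longleftrightarrow>
     scheduled \<sigma> \<pi> \<and> pmf (\<sigma> \<pi>) (Some (last_state \<pi>, a, \<mu>)) > 0"

definition maximal_path ::
  "('s, 'l) pa \<Rightarrow> ('s, 'l) scheduler \<Rightarrow> 's \<Rightarrow> ('s, 'l) pa_path \<Rightarrow> bool" where
  "maximal_path A \<sigma> s \<pi> \<longleftrightarrow>
     finite_path A \<pi> \<and> first_state \<pi> = s \<and> scheduled \<sigma> \<pi> \<and> pmf (\<sigma> \<pi>) None > 0"

text \<open>
  The terms below are nonnegative and all finite partial sums are at most 1 when \<open>\<sigma>\<close> is a
  scheduler for \<open>A\<close>, so the default value 0 of non-summable families plays no role.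
\<close>

definition final_dist ::
  "('s, 'l) pa \<Rightarrow> ('s, 'l) scheduler \<Rightarrow> 's \<Rightarrow> 's \<Rightarrow> real" where
  "final_dist A \<sigma> s s' =
     (\<Sum>\<^sub>\<infinity>\<pi> \<in> {\<pi>. maximal_path A \<sigma> s \<pi> \<and> last_state \<pi> = s'}.
        path_prob \<sigma> \<pi> * pmf (\<sigma> \<pi>) None)"

fun silent_within ::
  "('s, 'l) pa \<Rightarrow> ('s \<times> 's) set \<Rightarrow> 's \<Rightarrow> ('s, 'l) pa_path \<Rightarrow> bool" where
  "silent_within A R s (Start u) \<longleftrightarrow> True"
| "silent_within A R s (Step \<pi> a \<mu> t) \<longleftrightarrow>
     silent_within A R s \<pi> \<and> a = tau A \<and> (s, t) \<in> R"

text \<open>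
  For \<open>s (a\<^sub>1, \<mu>\<^sub>1) s\<^sub>1 \<dots> (a\<^sub>n, \<mu>\<^sub>n) s\<^sub>n\<close>, the following says \<open>n \<ge> 1\<close>, \<open>a\<^sub>n = a\<close>, and
  \<open>a\<^sub>i = \<tau>\<close>, \<open>(s, s\<^sub>i) \<in> R\<close> for all \<open>1 \<le> i < n\<close>. Neither \<open>\<mu>\<^sub>n\<close> nor \<open>s\<^sub>n\<close> is constrained.
\<close>

fun branching_path ::
  "('s, 'l) pa \<Rightarrow> ('s \<times> 's) set \<Rightarrow> 's \<Rightarrow> 'l \<Rightarrow> ('s, 'l) pa_path \<Rightarrow> bool" where
  "branching_path A R s a (Start u) \<longleftrightarrow> False"
| "branching_path A R s a (Step \<pi> b \<mu> t) \<longleftrightarrow> b = a \<and> silent_within A R s \<pi>"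

definition branching_step ::
  "('s, 'l) pa \<Rightarrow> ('s \<times> 's) set \<Rightarrow> 's \<Rightarrow> 'l \<Rightarrow> 's pmf \<Rightarrow> bool" where
  "branching_step A R s a \<mu> \<longleftrightarrow>
     (a = tau A \<and> \<mu> = return_pmf s) \<or>
     (\<exists>\<sigma>. is_scheduler A \<sigma> \<and>
          (\<forall>s' \<in> states A. final_dist A \<sigma> s s' = pmf \<mu> s') \<and>
          (\<forall>\<pi>. maximal_path A \<sigma> s \<pi> \<longrightarrow> branching_path A R s a \<pi>))"

definition branching_bisimulation :: "('s, 'l) pa \<Rightarrow> ('s \<times> 's) set \<Rightarrow> bool" where
  "branching_bisimulation A R \<longleftrightarrow>
     equiv (states A) R \<and>
     (\<forall>(s, t) \<in> R. \<forall>a \<mu>. (s, a, \<mu>) \<in> transitions A \<longrightarrow>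
        (\<exists>\<mu>' \<in> Distr (states A). branching_step A R t a \<mu>' \<and> dist_equiv (states A) R \<mu> \<mu>'))"

definition branching_bisimilar :: "('s, 'l) pa \<Rightarrow> 's \<Rightarrow> 's \<Rightarrow> bool" where
  "branching_bisimilar A p q \<longleftrightarrow> (\<exists>R. branching_bisimulation A R \<and> (p, q) \<in> R)"

definition det_tau_transitions :: "('s, 'l) pa \<Rightarrow> ('s, 'l) transition set" where
  "det_tau_transitions A =
     {(s, a, \<mu>) \<in> transitions A. a = tau A \<and> (\<exists>t. \<mu> = return_pmf t)}"

definition conf_step :: "('s, 'l) pa \<Rightarrow> ('s, 'l) transition set \<Rightarrow> ('s \<times> 's) set" where
  "conf_step A c = {(s, t). (s, tau A, return_pmf t) \<in> c}"

definition conf_reach :: "('s, 'l) pa \<Rightarrow> ('s, 'l) transition set \<Rightarrow> ('s \<times> 's) set" where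
  "conf_reach A c = (conf_step A c)\<^sup>*"

definition conf_connected :: "('s, 'l) pa \<Rightarrow> ('s, 'l) transition set \<Rightarrow> ('s \<times> 's) set" where
  "conf_connected A c = (conf_step A c \<union> (conf_step A c)\<inverse>)\<^sup>*"

text \<open>
  \<open>conf_reach\<close> is reflexive on the whole state type, hence the explicit restriction to the states
  of the automaton.
\<close>

definition conf_rel :: "('s, 'l) pa \<Rightarrow> ('s, 'l) transition set \<Rightarrow> ('s \<times> 's) set" where
  "conf_rel A c =
     {(s, s') \<in> states A \<times> states A.
        \<exists>u \<in> states A. (s, u) \<in> conf_reach A c \<and> (s', u) \<in> conf_reach A c}"

definition weakly_prob_confluent ::
  "('s, 'l) pa \<Rightarrow> ('s, 'l) transition set \<Rightarrow> bool" where
  "weakly_prob_confluent A c \<longleftrightarrow>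
     equiv (states A) (conf_rel A c) \<and>
     (\<forall>s \<in> states A. \<forall>t \<in> states A. (s, t) \<in> conf_reach A c \<longrightarrow>
        (\<forall>a \<in> actions A. \<forall>\<mu> \<in> Distr (states A). (s, a, \<mu>) \<in> transitions A \<longrightarrow>
           (\<exists>t' \<in> states A. (t, t') \<in> conf_reach A c \<and>
              ((\<exists>\<nu> \<in> Distr (states A).
                  (t', a, \<nu>) \<in> transitions A \<and> dist_equiv (states A) (conf_rel A c) \<mu> \<nu>) \<or>
               (a = tau A \<and> dist_equiv (states A) (conf_rel A c) \<mu> (return_pmf t'))))))"

end

(* The bisimulation is the confluence relation itself. If p and q both reach u by confluent
   steps and p has a transition, then confluence along p ->> u provides a matching transition
   after some further steps u ->> t'. Since q ->> t' as well, q mimics the transition by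
   walking along a fixed confluent path, which stays inside its own class, and then
   taking the matching transition. *)
theory Submission
  imports Defs
begin

section \<open>Paths with deterministic steps, and the choices that walk along them\<close>

fun prefixes :: "('s, 'l) pa_path \<Rightarrow> ('s, 'l) pa_path set" where
  "prefixes (Start s) = {Start s}"
| "prefixes (Step \<pi> a \<mu> t) = insert (Step \<pi> a \<mu> t) (prefixes \<pi>)"

text \<open>Once the transitions of such a path are chosen, each of its states is reached with
  certainty, so no probability is lost on the way.\<close>

fun dirac_path :: "('s, 'l) pa_path \<Rightarrow> bool" where
  "dirac_path (Start s) \<longleftrightarrow> True"
| "dirac_path (Step \<pi> a \<mu> t) \<longleftrightarrow> dirac_path \<pi> \<and> \<mu> = return_pmf t"

text \<open>
  The choice \<open>along \<rho> x\<close> walks along \<open>\<rho>\<close>, chooses \<open>x\<close> once \<open>\<rho>\<close> is completed, and stops on every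
  path that is not a prefix of \<open>\<rho>\<close>.
\<close>

fun along :: "('s, 'l) pa_path \<Rightarrow> ('s, 'l) transition option \<Rightarrow> ('s, 'l) pa_path
    \<Rightarrow> ('s, 'l) transition option" where
  "along (Start s) x \<pi> = (if \<pi> = Start s then x else None)"
| "along (Step \<rho> a \<mu> t) x \<pi> =
     (if \<pi> = Step \<rho> a \<mu> t then x else along \<rho> (Some (last_state \<rho>, a, \<mu>)) \<pi>)"

text \<open>Stopping off the prefixes of \<open>\<rho>\<close> makes the scheduler halt right after
  \<open>tr\<close>.\<close>

definition follow :: "('s, 'l) pa_path \<Rightarrow> ('s, 'l) transition \<Rightarrow> ('s, 'l) scheduler" where
  "follow \<rho> tr \<pi> = return_pmf (along \<rho> (Some tr) \<pi>)"

lemma size_prefixes: "\<pi> \<in> prefixes \<rho> \<Longrightarrow> size \<pi> \<le> size \<rho>"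
  by (induction \<rho>) auto

lemma prefixes_refl: "\<rho> \<in> prefixes \<rho>"
  by (cases \<rho>) auto

text \<open>A prefix is never larger than the path, but an added step makes it larger. Hence
  \<open>follow\<close> stops as soon as it has gone one step beyond \<open>\<rho>\<close>.\<close>

lemma Step_notin_prefixes: "Step \<rho> a \<mu> t \<notin> prefixes \<rho>"
  using size_prefixes by fastforce

lemma Start_in_prefixes: "Start (first_state \<rho>) \<in> prefixes \<rho>"
  by (induction \<rho>) auto

lemma prefixes_StepD: "Step \<pi> a \<mu> t \<in> prefixes \<rho> \<Longrightarrow> \<pi> \<in> prefixes \<rho>"
  by (induction \<rho>) (auto simp: prefixes_refl)

lemma dirac_path_prefix: "dirac_path \<rho> \<Longrightarrow> Step \<pi> a \<mu> t \<in> prefixes \<rho> \<Longrightarrow> \<mu> = return_pmf t"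
  by (induction \<rho>) auto

lemma along_self: "along \<rho> x \<rho> = x"
  by (cases \<rho>) auto

lemma along_eq_None_iff: "along \<rho> (Some tr) \<pi> = None \<longleftrightarrow> \<pi> \<notin> prefixes \<rho>"
  by (induction \<rho> arbitrary: tr) auto

text \<open>Only the choice at the end of \<open>\<rho>\<close> depends on \<open>x\<close>, and
  \<open>\<pi>\<close> is a proper prefix. The induction needs arbitrary \<open>x\<close> because
  each recursive call of \<open>along\<close> replaces it by the step just removed.\<close>

lemma along_prefix:
  "Step \<pi> a \<mu> t \<in> prefixes \<rho> \<Longrightarrow> along \<rho> x \<pi> = Some (last_state \<pi>, a, \<mu>)"
proof (induction \<rho> arbitrary: x)
  case (Step \<rho> b \<nu> u)
  show ?case
  proof (cases "Step \<pi> a \<mu> t = Step \<rho> b \<nu> u")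
    case True
    \<comment> \<open>Now \<open>\<pi>\<close> is \<open>\<rho>\<close>, so \<open>along\<close>
      passes to its recursive call, whose choice at the end of \<open>\<rho>\<close> is the removed
      step.\<close>
    have "\<rho> \<noteq> Step \<rho> b \<nu> u"
      using Step_notin_prefixes[of \<rho> b \<nu> u] prefixes_refl[of \<rho>] by metis
    with True show ?thesis by (simp add: along_self)
  next
    case False
    then have mem: "Step \<pi> a \<mu> t \<in> prefixes \<rho>"
      using Step.prems by auto
    then have "\<pi> \<noteq> Step \<rho> b \<nu> u"
      using prefixes_StepD Step_notin_prefixes by metis
    with Step.IH[OF mem] show ?thesis by simp
  qed
qed simp

text \<open>The target \<open>t\<close> stays open, since a chosen transition alone does not
  determine it; for Dirac steps it is recovered later.\<close>

lemma along_SomeD: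
  "along \<rho> (Some tr) \<pi> = Some (l, b, \<mu>) \<Longrightarrow>
     (\<pi> = \<rho> \<and> tr = (l, b, \<mu>)) \<or> (\<exists>t. Step \<pi> b \<mu> t \<in> prefixes \<rho>)"
proof (induction \<rho> arbitrary: tr)
  case (Step \<rho> d \<nu> u)
  then show ?case by (cases "\<pi> = Step \<rho> d \<nu> u") fastforce+
qed (auto split: if_splits)

text \<open>The final transition is generalized, as the recursion replaces it by the last step of
  \<open>\<rho>\<close>, which \<open>finite_path\<close> makes a transition of
  \<open>A\<close>.\<close>

lemma along_transition:
  assumes "finite_path A \<rho>" "(last_state \<rho>, a, \<nu>) \<in> transitions A"
    and "along \<rho> (Some (last_state \<rho>, a, \<nu>)) \<pi> = Some tr"
  shows "tr \<in> transitions A \<and> fst tr = last_state \<pi>"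
  using assms
proof (induction \<rho> arbitrary: a \<nu>)
  case (Step \<rho> d \<mu> u)
  then show ?case by (cases "\<pi> = Step \<rho> d \<mu> u") auto
qed (auto split: if_splits)

section \<open>The scheduler along a deterministic path and its final distribution\<close>

lemma is_scheduler_follow:
  assumes "finite_path A \<rho>" "(last_state \<rho>, a, \<nu>) \<in> transitions A"
  shows "is_scheduler A (follow \<rho> (last_state \<rho>, a, \<nu>))"
  unfolding is_scheduler_def
proof (intro allI impI)
  fix \<pi>
  show "set_pmf (follow \<rho> (last_state \<rho>, a, \<nu>) \<pi>)
     \<subseteq> insert None (Some ` {tr \<in> transitions A. fst tr = last_state \<pi>})"
    using along_transition[OF assms]
    by (cases "along \<rho> (Some (last_state \<rho>, a, \<nu>)) \<pi>") (auto simp: follow_def)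
qed

text \<open>At a proper prefix the next step is chosen surely, and a Dirac step surely reaches its
  target, so every factor of the path probability is 1.\<close>

lemma follow_prefix:
  assumes "dirac_path \<rho>" "\<pi> \<in> prefixes \<rho>"
  shows "scheduled (follow \<rho> tr) \<pi>
    \<and> path_prob (follow \<rho> tr) \<pi> = 1"
  using assms(2)
proof (induction \<pi>)
  case (Step \<pi> a \<mu> t)
  have "\<mu> = return_pmf t"
    using dirac_path_prefix assms(1) Step.prems by metis
  with Step.IH[OF prefixes_StepD[OF Step.prems]] along_prefix[OF Step.prems]
  show ?case by (simp add: follow_def)
qed simp

text \<open>Looking at the last step of \<open>\<pi>\<close> suffices: a transition is chosen only
  at prefixes of \<open>\<rho>\<close>, and it is either the next step of \<open>\<rho>\<close> or
  the final transition.\<close>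

lemma scheduled_follow:
  assumes "dirac_path \<rho>" "finite_path A \<pi>" "first_state \<pi> = first_state \<rho>"
    and "scheduled (follow \<rho> (last_state \<rho>, a, \<nu>)) \<pi>"
  shows "\<pi> \<in> prefixes \<rho> \<or> (\<exists>t. \<pi> = Step \<rho> a \<nu> t \<and> pmf \<nu> t > 0)"
  using assms(2-)
proof (induction \<pi>)
  case (Start u)
  then show ?case using Start_in_prefixes[of \<rho>] by simp
next
  case (Step \<pi> b \<mu> t)
  have pos: "pmf \<mu> t > 0"
    using Step.prems(1) by simp
  have "pmf (follow \<rho> (last_state \<rho>, a, \<nu>) \<pi>) (Some (last_state \<pi>, b, \<mu>)) > 0"
    using Step.prems(3) by simp
  then have "along \<rho> (Some (last_state \<rho>, a, \<nu>)) \<pi> = Some (last_state \<pi>, b, \<mu>)"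
    by (simp add: follow_def indicator_def split: if_splits)
  from along_SomeD[OF this] show ?case
  proof (elim disjE exE conjE)
    fix t' assume mem: "Step \<pi> b \<mu> t' \<in> prefixes \<rho>"
    \<comment> \<open>The distribution \<open>\<mu>\<close> is concentrated on \<open>t'\<close>,
      yet gives \<open>t\<close> positive probability.\<close>
    have "t = t'"
      using pos dirac_path_prefix[OF assms(1) mem] by (simp add: indicator_def split: if_splits)
    with mem show ?thesis by simp
  next
    assume "\<pi> = \<rho>" "(last_state \<rho>, a, \<nu>) = (last_state \<pi>, b, \<mu>)"
    with pos show ?thesis by simp
  qed
qed

text \<open>Stopping happens exactly off the prefixes of \<open>\<rho>\<close>, and the only
  scheduled paths there take the final transition once.\<close>

lemma maximal_path_follow_iff:
  assumes "dirac_path \<rho>" "finite_path A \<rho>" "(last_state \<rho>, a, \<nu>) \<in> transitions A"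
  shows "maximal_path A (follow \<rho> (last_state \<rho>, a, \<nu>))
      (first_state \<rho>) \<pi> \<longleftrightarrow> (\<exists>t. \<pi> = Step \<rho> a \<nu> t \<and> pmf \<nu> t > 0)"
    (is "maximal_path A ?\<sigma> _ _ \<longleftrightarrow> ?R")
proof
  assume max: "maximal_path A ?\<sigma> (first_state \<rho>) \<pi>"
  then have "along \<rho> (Some (last_state \<rho>, a, \<nu>)) \<pi> = None"
    by (simp add: maximal_path_def follow_def indicator_def split: if_splits)
  then have "\<pi> \<notin> prefixes \<rho>"
    by (simp add: along_eq_None_iff)
  moreover have path: "finite_path A \<pi>" "first_state \<pi> = first_state \<rho>" "scheduled ?\<sigma> \<pi>"
    using max by (simp_all add: maximal_path_def)
  ultimately show ?R
    using scheduled_follow[OF assms(1) path] by simp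
next
  assume ?R
  then obtain t where t: "\<pi> = Step \<rho> a \<nu> t" "pmf \<nu> t > 0" by blast
  have "along \<rho> (Some (last_state \<rho>, a, \<nu>)) \<pi> = None"
    using t Step_notin_prefixes by (simp add: along_eq_None_iff)
  then show "maximal_path A ?\<sigma> (first_state \<rho>) \<pi>"
    using t assms follow_prefix[OF assms(1) prefixes_refl]
    by (simp add: maximal_path_def follow_def along_self)
qed

text \<open>At most one maximal path ends in \<open>t\<close>. It exists if \<open>t\<close> is in
  the support of \<open>\<nu>\<close>, and all its factors except \<open>pmf \<nu> t\<close> are 1;
  otherwise the sum is empty.\<close>

lemma final_dist_follow:
  assumes "dirac_path \<rho>" "finite_path A \<rho>" "(last_state \<rho>, a, \<nu>) \<in> transitions A"
  shows "final_dist A (follow \<rho> (last_state \<rho>, a, \<nu>))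
      (first_state \<rho>) t = pmf \<nu> t"
    (is "final_dist A ?\<sigma> _ _ = _")
proof (cases "pmf \<nu> t > 0")
  case True
  then have eq: "{\<pi>. maximal_path A ?\<sigma> (first_state \<rho>) \<pi> \<and> last_state \<pi> = t}
      = {Step \<rho> a \<nu> t}"
    using maximal_path_follow_iff[OF assms] by auto
  have "along \<rho> (Some (last_state \<rho>, a, \<nu>)) (Step \<rho> a \<nu> t) = None"
    using Step_notin_prefixes by (simp add: along_eq_None_iff)
  then show ?thesis
    using follow_prefix[OF assms(1) prefixes_refl]
    unfolding final_dist_def eq by (simp add: follow_def along_self)
next
  case False
  then have "{\<pi>. maximal_path A ?\<sigma> (first_state \<rho>) \<pi> \<and> last_state \<pi> = t} = {}"
    using maximal_path_follow_iff[OF assms] by auto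
  then have "final_dist A ?\<sigma> (first_state \<rho>) t = 0"
    unfolding final_dist_def by (simp only: infsum_empty)
  with False show ?thesis
    by (simp add: order_less_le)
qed

text \<open>Every maximal path is \<open>\<rho>\<close> plus one step labelled \<open>a\<close>, so
  the part that must be silent is exactly \<open>\<rho>\<close>.\<close>

lemma branching_step_dirac_path:
  assumes "dirac_path \<rho>" "finite_path A \<rho>" "silent_within A R (first_state \<rho>) \<rho>"
    and "(last_state \<rho>, a, \<nu>) \<in> transitions A"
  shows "branching_step A R (first_state \<rho>) a \<nu>"
  unfolding branching_step_def
proof (intro disjI2 exI conjI)
  show "is_scheduler A (follow \<rho> (last_state \<rho>, a, \<nu>))"
    by (rule is_scheduler_follow[OF assms(2,4)])
qed (use assms(3) in \<open>auto simp: final_dist_follow[OF assms(1,2,4)]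
      maximal_path_follow_iff[OF assms(1,2,4)]\<close>)

section \<open>Confluent walks as branching steps\<close>

lemma conf_reach_states:
  assumes "prob_automaton A" "c \<subseteq> det_tau_transitions A"
    and "(s, t) \<in> conf_reach A c" "s \<in> states A"
  shows "t \<in> states A"
  using assms(3,4) unfolding conf_reach_def
proof (induction rule: rtrancl_induct)
  case (step y z)
  then show ?case
    using assms(1,2)
    by (auto simp: conf_step_def det_tau_transitions_def prob_automaton_def Distr_def)
qed

text \<open>The common successor is \<open>t\<close> itself.\<close>

lemma conf_reach_conf_rel:
  assumes "prob_automaton A" "c \<subseteq> det_tau_transitions A"
    and "(s, t) \<in> conf_reach A c" "s \<in> states A"
  shows "(s, t) \<in> conf_rel A c"
  using conf_reach_states[OF assms] assms(3,4) by (auto simp: conf_rel_def conf_reach_def)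

text \<open>Each visited state is reached from \<open>s\<close> by confluent steps and hence related
  to \<open>s\<close>. This includes \<open>t\<close>, which becomes an intermediate state once a
  further transition is appended.\<close>

lemma conf_reach_path:
  assumes "prob_automaton A" "c \<subseteq> det_tau_transitions A"
    and "(s, t) \<in> conf_reach A c" "s \<in> states A"
  obtains \<rho> where "dirac_path \<rho>" "finite_path A \<rho>" "first_state \<rho> = s" "last_state \<rho> = t"
    "silent_within A (conf_rel A c) s \<rho>"
proof -
  have "\<exists>\<rho>. dirac_path \<rho> \<and> finite_path A \<rho> \<and> first_state \<rho> = s \<and> last_state \<rho> = t
      \<and> silent_within A (conf_rel A c) s \<rho>"
    using assms(3) unfolding conf_reach_def
  proof (induction rule: rtrancl_induct)
    case base
    show ?case using assms(4) by (intro exI[of _ "Start s"]) simp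
  next
    case (step y z)
    then obtain \<rho> where "dirac_path \<rho>" "finite_path A \<rho>" "first_state \<rho> = s"
      "last_state \<rho> = y" "silent_within A (conf_rel A c) s \<rho>" by blast
    moreover have "(s, z) \<in> conf_reach A c"
      using step.hyps by (auto simp: conf_reach_def)
    then have "(s, z) \<in> conf_rel A c"
      using conf_reach_conf_rel assms(1,2,4) by metis
    moreover have "(y, tau A, return_pmf z) \<in> transitions A"
      using step.hyps assms(2) by (auto simp: conf_step_def det_tau_transitions_def)
    ultimately show ?case
      by (intro exI[of _ "Step \<rho> (tau A) (return_pmf z) z"]) simp
  qed
  then show ?thesis using that by blast
qed

lemma branching_step_conf_reach:
  assumes "prob_automaton A" "c \<subseteq> det_tau_transitions A"
    and "(s, t) \<in> conf_reach A c" "s \<in> states A"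
    and "(t, a, \<nu>) \<in> transitions A"
  shows "branching_step A (conf_rel A c) s a \<nu>"
  using conf_reach_path[OF assms(1-4)] branching_step_dirac_path assms(5) by metis

text \<open>An empty walk is the idle clause of \<open>branching_step\<close>. In a nonempty one,
  the last confluent step plays the role of the matching transition, which keeps the path length at
  least 1.\<close>

lemma branching_step_conf_reach_tau:
  assumes "prob_automaton A" "c \<subseteq> det_tau_transitions A"
    and "(s, t) \<in> conf_reach A c" "s \<in> states A"
  shows "branching_step A (conf_rel A c) s (tau A) (return_pmf t)"
  using assms(3) unfolding conf_reach_def
proof (cases rule: rtranclE)
  case base
  then show ?thesis by (simp add: branching_step_def)
next
  case (step y)
  then have "(y, tau A, return_pmf t) \<in> transitions A"
    using assms(2) by (auto simp: conf_step_def det_tau_transitions_def)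
  with step(1) show ?thesis
    using branching_step_conf_reach[OF assms(1,2) _ assms(4)] by (simp add: conf_reach_def)
qed

section \<open>The confluence relation as a bisimulation\<close>

lemma conf_rel_branching_bisimulation:
  assumes A: "prob_automaton A" and c: "c \<subseteq> det_tau_transitions A"
    and conf: "weakly_prob_confluent A c"
  shows "branching_bisimulation A (conf_rel A c)"
proof -
  have "\<exists>\<mu>' \<in> Distr (states A). branching_step A (conf_rel A c) q a \<mu>'
      \<and> dist_equiv (states A) (conf_rel A c) \<mu> \<mu>'"
    if pq: "(p, q) \<in> conf_rel A c" and tr: "(p, a, \<mu>) \<in> transitions A" for p q a \<mu>
  proof -
    obtain u where u: "p \<in> states A" "q \<in> states A" "u \<in> states A"
      "(p, u) \<in> conf_reach A c" "(q, u) \<in> conf_reach A c"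
      using pq by (auto simp: conf_rel_def)
    have "a \<in> actions A" "\<mu> \<in> Distr (states A)"
      using A tr by (auto simp: prob_automaton_def)
    with conf u tr obtain t' where t': "t' \<in> states A" "(u, t') \<in> conf_reach A c"
      and alt: "(\<exists>\<nu> \<in> Distr (states A). (t', a, \<nu>) \<in> transitions A
            \<and> dist_equiv (states A) (conf_rel A c) \<mu> \<nu>)
          \<or> (a = tau A \<and> dist_equiv (states A) (conf_rel A c) \<mu> (return_pmf t'))"
      unfolding weakly_prob_confluent_def by meson
    have qt': "(q, t') \<in> conf_reach A c"
      using u(5) t'(2) unfolding conf_reach_def by (rule rtrancl_trans)
    from alt show ?thesis
    proof (elim disjE bexE conjE)
      fix \<nu>
      assume "\<nu> \<in> Distr (states A)" "(t', a, \<nu>) \<in> transitions A"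
        "dist_equiv (states A) (conf_rel A c) \<mu> \<nu>"
      then show ?thesis
        using branching_step_conf_reach[OF A c qt' u(2)] by blast
    next
      \<comment> \<open>The transition is matched by resting at \<open>t'\<close>, so the walk from
        \<open>q\<close> to \<open>t'\<close> is already the whole answer.\<close>
      assume "a = tau A" "dist_equiv (states A) (conf_rel A c) \<mu> (return_pmf t')"
      moreover have "return_pmf t' \<in> Distr (states A)"
        using t'(1) by (simp add: Distr_def)
      ultimately show ?thesis
        using branching_step_conf_reach_tau[OF A c qt' u(2)] by blast
    qed
  qed
  with conf show ?thesis
    by (auto simp: branching_bisimulation_def weakly_prob_confluent_def)
qed

text \<open>The relation contains every confluent step, and weak confluence makes it an equivalence,
  so it absorbs zigzags of such steps.\<close>

lemma conf_connected_conf_rel: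
  assumes "prob_automaton A" "c \<subseteq> det_tau_transitions A" "weakly_prob_confluent A c"
    and "(s, s') \<in> conf_connected A c" "s \<in> states A"
  shows "(s, s') \<in> conf_rel A c"
proof -
  have eq: "equiv (states A) (conf_rel A c)"
    using assms(3) by (simp add: weakly_prob_confluent_def)
  have step_rel: "(x, y) \<in> conf_rel A c" if "(x, y) \<in> conf_step A c" for x y
  proof (rule conf_reach_conf_rel[OF assms(1,2)])
    show "(x, y) \<in> conf_reach A c" using that by (auto simp: conf_reach_def)
    show "x \<in> states A"
      using that assms(1,2)
      by (auto simp: conf_step_def det_tau_transitions_def prob_automaton_def)
  qed
  show ?thesis
    using assms(4) unfolding conf_connected_def
  proof (induction rule: rtrancl_induct)
    case base
    show ?case using eq assms(5) by (simp add: equiv_def refl_on_def)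
  next
    case (step y z)
    then have "(y, z) \<in> conf_rel A c"
      using step_rel eq by (auto simp: equiv_def dest: symD)
    with step.IH show ?case
      using eq by (meson equiv_def transD)
  qed
qed

theorem theorem19:
  fixes A :: "('s, 'l) pa"
    and c :: "('s, 'l) transition set"
    and s s' :: 's
  assumes "prob_automaton A"
    and "s \<in> states A" and "s' \<in> states A"
    and "c \<subseteq> det_tau_transitions A"
    and "weakly_prob_confluent A c"
    and "(s, s') \<in> conf_connected A c"
  shows "branching_bisimilar A s s'"
  using conf_rel_branching_bisimulation conf_connected_conf_rel assms
  unfolding branching_bisimilar_def by metis

end
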